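(* Let $X$ and $Y$ be separable Banach spaces such that $B_X$ and $B_Y$ are the closed convex hulls of sets of uniformly strongly exposed points (of $B_X$ and $B_Y$, respectively). Then $\mathcal L(X,Y^* )$ and $\mathcal L(Y,X^* )$ both have the uniform ball-covering property (UBCP), and $\operatorname{bc}(\mathcal L(X,Y^* ))=\operatorname{bc}(\mathcal L(Y,X^* ))=1$.
   Context: All Banach spaces are real. $B_X$, $S_X$ denote the closed unit ball and the unit sphere; $B(x,r)$ is the open ball with center $x$ and radius $r>0$. $\mathcal L(X,Z)$ is the Banach space of bounded linear operators from $X$ to $Z$ with the operator norm. A subset $U\subset S_X$ is a set of uniformly strongly exposed points if there is a family $\{f_u\}_{u\in U}\subset X^*$ with $\|f_u\|=f_u(u)=1$ for every $u\in U$, such that for every $\varepsilon>0$ there is $\delta>0$ such that whenever $z\in B_X$ and $u\in U$ satisfy $f_u(z)>1-\delta$, then $\|u-z\|<\varepsilon$. A Banach space $Z$ has the UBCP if there are $r,\alpha>0$ and a countable collection of open balls $\{B(z_n,r_n)\}$ with $S_Z\subset\bigcup_nB(z_n,r_n)$, $\|z_n\|\ge r_n+\alpha$ for all $n$, and $\sup_n r_n\le r$. For $\alpha\in[-1,1)$, $Z$ has the $\alpha$-BCP if there is a countable collection of open balls $\{B(z_n,r_n)\}$, $r_n>0$, with $S_Z\subset\bigcup_n B(z_n,r_n)$ and $\|z_n\|\ge r_n+\alpha$ for all $n$. The ball-covering index is $\operatorname{bc}(Z):=\sup\{\alpha\in[-1,1): Z\text{ has the }\alpha\text{-BCP}\}$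 ($=-1$ if this set is empty). *)

theory Defs
  imports "HOL-Analysis.Analysis"
begin

text \<open>
  Banach spaces are types of class \<^class>\<open>banach\<close> (real scalars); the dual of a space is the type
  of bounded linear maps to \<^typ>\<open>real\<close>, with the operator norm.
\<close>

definition uniformly_strongly_exposed :: "'a::real_normed_vector set \<Rightarrow> bool" where
  "uniformly_strongly_exposed U \<longleftrightarrow>
     U \<subseteq> sphere 0 1 \<and>
     (\<exists>f :: 'a \<Rightarrow> ('a \<Rightarrow>\<^sub>L real).
        (\<forall>u\<in>U. norm (f u) = 1 \<and> blinfun_apply (f u) u = 1) \<and>
        (\<forall>\<epsilon>>0. \<exists>\<delta>>0. \<forall>z\<in>cball 0 1. \<forall>u\<in>U.
           blinfun_apply (f u) z > 1 - \<delta> \<longrightarrow> norm (u - z) < \<epsilon>))"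

text \<open>
  The covering properties below depend only on the space, which is passed as a type argument.
  A collection of open balls is given by the set of its pairs (centre, radius), because a ball, as a
  set, need not determine its centre and radius (on the zero space).
\<close>

definition countable_ball_covering :: "('a::real_normed_vector \<times> real) set \<Rightarrow> bool" where
  "countable_ball_covering C \<longleftrightarrow>
     countable C \<and> (\<forall>(z, r)\<in>C. r > 0) \<and> sphere 0 1 \<subseteq> (\<Union>(z, r)\<in>C. ball z r)"

definition UBCP :: "'a::real_normed_vector itself \<Rightarrow> bool" where
  "UBCP T \<longleftrightarrow>
     (\<exists>R>0. \<exists>\<alpha>>0. \<exists>C :: ('a \<times> real) set.
        countable_ball_covering C \<and> (\<forall>(z, r)\<in>C. norm z \<ge> r + \<alpha> \<and> r \<le> R))"

definition BCP :: "real \<Rightarrow> 'a::real_normed_vector itself \<Rightarrow> bool" where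
  "BCP \<alpha> T \<longleftrightarrow>
     (\<exists>C :: ('a \<times> real) set.
        countable_ball_covering C \<and> (\<forall>(z, r)\<in>C. norm z \<ge> r + \<alpha>))"

definition bc :: "'a::real_normed_vector itself \<Rightarrow> real" where
  "bc T = (let A = {\<alpha>\<in>{-1..<1}. BCP \<alpha> T} in if A = {} then -1 else Sup A)"

end

theory Submission
  imports Defs
begin

text \<open>
  A norm-one operator \<open>T\<close>, viewed as a bilinear form, almost attains its norm at a pair \<open>(u, v)\<close> of
  strongly exposed points, taken from countable nets. If \<open>f\<close> and \<open>g\<close> expose \<open>u\<close> and \<open>v\<close> then, for
  large \<open>\<lambda>\<close>, the form \<open>\<lambda> f \<otimes> g - T\<close> is at most \<open>\<lambda> - \<alpha>\<close> on the unit balls: either \<open>\<bar>f x g y\<bar>\<close> is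
  bounded away from \<open>1\<close>, and \<open>\<lambda>\<close> beats \<open>T\<close>, or up to signs \<open>(x, y)\<close> is near \<open>(u, v)\<close>, where \<open>T\<close> is
  almost \<open>1\<close>. Uniformity of the exposition makes \<open>\<lambda>\<close> independent of \<open>T\<close>.
\<close>

text \<open>Points of a countable dense set may lie outside \<open>U\<close>, so each one that is
  close to \<open>U\<close> is replaced by a nearby point of \<open>U\<close>. The two distances of
  \<open>e / 2\<close> add up to \<open>e\<close>.\<close>

lemma countable_net_of_separable:
  fixes U :: "'a::metric_space set"
  assumes "separable_space (euclidean :: 'a topology)" and "e > 0"
  obtains N where "countable N" "N \<subseteq> U" "\<And>u. u \<in> U \<Longrightarrow> \<exists>n\<in>N. dist u n < e"
proof -
  obtain D :: "'a set" where D: "countable D" "closure D = UNIV"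
    using assms(1) by (auto simp: separable_space_def)
  \<comment> \<open>\<open>c d\<close> is an arbitrary value when no point of \<open>U\<close> is
    within \<open>e / 2\<close> of \<open>d\<close>; the filter in \<open>N\<close> discards such
    \<open>d\<close>.\<close>
  define c where "c d = (SOME u. u \<in> U \<and> dist u d < e / 2)" for d
  define N where "N = c ` {d \<in> D. \<exists>u\<in>U. dist u d < e / 2}"
  have c: "c d \<in> U \<and> dist (c d) d < e / 2" if "u \<in> U" "dist u d < e / 2" for u d
    unfolding c_def by (rule someI[of _ u]) (use that in simp)
  have "\<exists>n\<in>N. dist u n < e" if u: "u \<in> U" for u
  proof -
    have "u \<in> closure D" by (simp add: D)
    then obtain d where d: "d \<in> D" "dist d u < e / 2"
      using \<open>e > 0\<close> by (meson closure_approachable half_gt_zero)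
    then have *: "dist u d < e / 2" by (simp add: dist_commute)
    then have "c d \<in> N" unfolding N_def using d(1) u by blast
    moreover have "dist u (c d) < e"
      using c[OF u *] * dist_triangle2[of u "c d" d] by linarith
    ultimately show ?thesis by blast
  qed
  moreover have "countable N" "N \<subseteq> U"
    using D c by (auto simp: N_def)
  ultimately show ?thesis using that by blast
qed

text \<open>The half-space where \<open>f\<close> is at most \<open>c\<close> is closed and convex,
  hence contains the closed convex hull of each of its subsets.\<close>

lemma bounded_linear_le_on_closed_convex_hull:
  fixes f :: "'a::real_normed_vector \<Rightarrow> real"
  assumes f: "bounded_linear f" and "\<And>u. u \<in> U \<Longrightarrow> f u \<le> c" and "x \<in> closure (convex hull U)"
  shows "f x \<le> c"
proof -
  have "{x. f x \<le> c} = f -` {..c}" by auto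
  moreover have "convex (f -` {..c})"
    using f by (intro convex_linear_vimage) (auto dest: bounded_linear.linear)
  moreover have "closed (f -` {..c})"
    using f by (intro closed_vimage) (auto intro: linear_continuous_on)
  ultimately have "closure (convex hull U) \<subseteq> {x. f x \<le> c}"
    using assms(2) by (intro closure_minimal hull_minimal) auto
  then show ?thesis using assms(3) by blast
qed

lemma norm_blinfun_le_on_cball:
  fixes T :: "'a::real_normed_vector \<Rightarrow>\<^sub>L 'c::real_normed_vector"
  assumes "0 \<le> c" and "\<And>x. x \<in> cball 0 1 \<Longrightarrow> norm (T x) \<le> c"
  shows "norm T \<le> c"
proof (rule norm_blinfun_bound[OF \<open>0 \<le> c\<close>])
  fix x
  show "norm (T x) \<le> c * norm x"
  proof (cases "x = 0")
    case False
    have "norm (T (x /\<^sub>R norm x)) \<le> c"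
      using False by (intro assms(2)) simp
    then show ?thesis
      using False by (simp add: blinfun.scaleR_right field_simps)
  qed simp
qed

lemma norm_bilinear_le_on_cball:
  fixes T :: "'a::real_normed_vector \<Rightarrow>\<^sub>L 'b::real_normed_vector \<Rightarrow>\<^sub>L real"
  assumes "0 \<le> c" and "\<And>x y. x \<in> cball 0 1 \<Longrightarrow> y \<in> cball 0 1 \<Longrightarrow> \<bar>T x y\<bar> \<le> c"
  shows "norm T \<le> c"
  using assms(1)
proof (rule norm_blinfun_le_on_cball)
  fix x :: 'a assume "x \<in> cball 0 1"
  then show "norm (T x) \<le> c"
    using assms by (intro norm_blinfun_le_on_cball) auto
qed

lemma abs_bilinear_le:
  fixes T :: "'a::real_normed_vector \<Rightarrow>\<^sub>L 'b::real_normed_vector \<Rightarrow>\<^sub>L real"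
  shows "\<bar>T x y\<bar> \<le> norm T * norm x * norm y"
  using norm_blinfun[of "T x" y] mult_right_mono[OF norm_blinfun[of T x], of "norm y"]
  by simp

lemma bilinear_diff_le:
  fixes T :: "'a::real_normed_vector \<Rightarrow>\<^sub>L 'b::real_normed_vector \<Rightarrow>\<^sub>L real"
  assumes "norm T \<le> 1" "norm v \<le> 1" "norm x \<le> 1" "norm (u - x) \<le> e" "norm (v - y) \<le> e"
  shows "T u v - T x y \<le> 2 * e"
proof -
  have "0 \<le> e" using assms(4) norm_ge_zero order_trans by blast
  have "T u v - T x y = T (u - x) v + T x (v - y)"
    by (simp add: blinfun.diff_left blinfun.diff_right)
  moreover have "\<bar>T (u - x) v\<bar> \<le> 1 * e * 1"
    by (rule order_trans[OF abs_bilinear_le]) (use assms \<open>0 \<le> e\<close> in \<open>intro mult_mono; simp\<close>)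
  moreover have "\<bar>T x (v - y)\<bar> \<le> 1 * 1 * e"
    by (rule order_trans[OF abs_bilinear_le]) (use assms \<open>0 \<le> e\<close> in \<open>intro mult_mono; simp\<close>)
  ultimately show ?thesis by linarith
qed

text \<open>Otherwise the bound \<open>c\<close> on \<open>U\<close> times \<open>V\<close> extends
  to the unit balls one variable at a time, because \<open>T\<close> is linear in each variable
  separately.\<close>

lemma bilinear_almost_attains_norm:
  fixes T :: "'a::real_normed_vector \<Rightarrow>\<^sub>L 'b::real_normed_vector \<Rightarrow>\<^sub>L real"
  assumes U: "cball 0 1 = closure (convex hull U)" and V: "cball 0 1 = closure (convex hull V)"
    and c: "0 \<le> c" "c < norm T"
  obtains u v where "u \<in> U" "v \<in> V" "T u v > c"
proof -
  have "\<exists>u\<in>U. \<exists>v\<in>V. T u v > c"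
  proof (rule ccontr)
    assume "\<not> ?thesis"
    then have 1: "T u v \<le> c" if "u \<in> U" "v \<in> V" for u v
      using that by (meson not_le)
    have 2: "T u y \<le> c" if "u \<in> U" "y \<in> cball 0 1" for u y
      using bounded_linear_le_on_closed_convex_hull[of "T u" V c y] 1 that V
      by (simp add: blinfun.bounded_linear_right)
    have 3: "T x y \<le> c" if "x \<in> cball 0 1" "y \<in> cball 0 1" for x y
      using bounded_linear_le_on_closed_convex_hull[of "\<lambda>x. T x y" U c x] 2 that U
        bounded_linear_compose[OF blinfun.bounded_linear_left blinfun.bounded_linear_right, of T y]
      by simp
    \<comment> \<open>The unit ball is symmetric, so replacing \<open>y\<close> by
      \<open>- y\<close> turns the one-sided bound into a bound on the absolute value.\<close>
    have "\<bar>T x y\<bar> \<le> c" if "x \<in> cball 0 1" "y \<in> cball 0 1" for x y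
      using 3[of x y] 3[of x "- y"] that by (simp add: blinfun.minus_right)
    then have "norm T \<le> c"
      by (intro norm_bilinear_le_on_cball[OF c(1)])
    with c(2) show False by simp
  qed
  with that show ?thesis by blast
qed

text \<open>The elementary tensor of \<open>f\<close> and \<open>z\<close>. When \<open>z\<close> is
  a functional \<open>g\<close>, it is the bilinear form sending \<open>(x, y)\<close> to
  \<open>f x * g y\<close>.\<close>

definition rank_one :: "('a::real_normed_vector \<Rightarrow>\<^sub>L real) \<Rightarrow> 'c::real_normed_vector \<Rightarrow> 'a \<Rightarrow>\<^sub>L 'c" where
  "rank_one f z = blinfun_scaleR_left z o\<^sub>L f"

lemma rank_one_apply [simp]: "rank_one f z x = f x *\<^sub>R z"
  by (simp add: rank_one_def)

lemma norm_rank_one: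
  fixes f :: "'a::real_normed_vector \<Rightarrow>\<^sub>L real"
  assumes "norm u = 1" "f u = 1"
  shows "norm z \<le> norm (rank_one f z)"
  using norm_blinfun[of "rank_one f z" u] assms by simp

text \<open>The choice \<open>L * \<delta> = 2\<close> settles the far case: there the tensor part
  is at most \<open>L * (1 - \<delta>) = L - 2\<close>, and \<open>T\<close> adds at most 1. In the
  near case \<open>T x y\<close> exceeds \<open>1 - 5 * e\<close>: the hypothesis at
  \<open>(u, v)\<close> loses \<open>3 * e\<close>, and moving to \<open>(x, y)\<close> loses
  \<open>2 * e\<close>.\<close>

lemma norm_scaled_rank_one_diff_le:
  fixes T :: "'a::real_normed_vector \<Rightarrow>\<^sub>L 'b::real_normed_vector \<Rightarrow>\<^sub>L real"
    and f :: "'a \<Rightarrow>\<^sub>L real" and g :: "'b \<Rightarrow>\<^sub>L real"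
  assumes T: "norm T = 1" and v: "norm v = 1"
    and f: "norm f = 1" and g: "norm g = 1"
    and fu: "\<And>x. x \<in> cball 0 1 \<Longrightarrow> f x > 1 - \<delta> \<Longrightarrow> norm (u - x) < e"
    and gv: "\<And>y. y \<in> cball 0 1 \<Longrightarrow> g y > 1 - \<delta> \<Longrightarrow> norm (v - y) < e"
    and Tuv: "T u v > 1 - 3 * e"
    and e: "0 < e" and \<delta>: "0 < \<delta>" "\<delta> \<le> 1" and L: "L * \<delta> = 2"
  shows "norm (L *\<^sub>R rank_one f g - T) \<le> L - (1 - 5 * e)"
proof (rule norm_bilinear_le_on_cball)
  have L2: "L \<ge> 2"
    using L \<delta> mult_left_mono[of \<delta> 1 L] by (smt (verit) mult_nonneg_nonneg mult_less_0_iff)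
  then show "0 \<le> L - (1 - 5 * e)" using e by simp
  fix x :: 'a and y :: 'b assume xy: "x \<in> cball 0 1" "y \<in> cball 0 1"
  have f1: "\<bar>f x\<bar> \<le> 1" and g1: "\<bar>g y\<bar> \<le> 1"
    using norm_blinfun[of f x] norm_blinfun[of g y] f g xy by auto
  have T1: "\<bar>T x y\<bar> \<le> 1" if "x \<in> cball 0 1" "y \<in> cball 0 1" for x y
    using abs_bilinear_le[of T x y] mult_mono[of "norm x" 1 "norm y" 1] that T by auto
  \<comment> \<open>From above, the tensor part is at most \<open>L\<close> and \<open>T x y\<close>
    is almost 1. From below, the tensor part is nonnegative and \<open>T x y\<close> is at most 1,
    which suffices because \<open>L \<ge> 2\<close>.\<close>
  have near: "\<bar>L * (f x * g y) - T x y\<bar> \<le> L - (1 - 5 * e)"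
    if xy: "x \<in> cball 0 1" "y \<in> cball 0 1" "f x > 1 - \<delta>" "g y > 1 - \<delta>" "f x \<le> 1" "g y \<le> 1" for x y
  proof -
    have "T u v - T x y \<le> 2 * e"
      using fu[OF xy(1,3)] gv[OF xy(2,4)] T v xy by (intro bilinear_diff_le) auto
    moreover have "0 \<le> f x * g y" "f x * g y \<le> 1"
      using xy \<delta> by (auto intro!: mult_le_one)
    then have "0 \<le> L * (f x * g y)" "L * (f x * g y) \<le> L"
      using L2 by (auto intro!: mult_left_le)
    ultimately show ?thesis using T1[OF xy(1,2)] Tuv L2 e by linarith
  qed
  have "\<bar>L * (f x * g y) - T x y\<bar> \<le> L - (1 - 5 * e)"
  proof (cases "\<bar>f x * g y\<bar> \<le> 1 - \<delta>")
    case True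
    have "\<bar>L * (f x * g y)\<bar> = L * \<bar>f x * g y\<bar>" using L2 by (simp add: abs_mult)
    also have "\<dots> \<le> L * (1 - \<delta>)" using True L2 by (intro mult_left_mono) auto
    also have "\<dots> = L - 2" using L by (simp add: algebra_simps)
    finally show ?thesis using T1[OF xy] e by linarith
  next
    case False
    \<comment> \<open>Both factors have absolute value at most 1, so each is at least as large in
      absolute value as the product.\<close>
    then have "\<bar>f x\<bar> > 1 - \<delta>" "\<bar>g y\<bar> > 1 - \<delta>"
      using f1 g1 mult_left_le[of "\<bar>g y\<bar>" "\<bar>f x\<bar>"] mult_right_le_one_le[of "\<bar>g y\<bar>" "\<bar>f x\<bar>"]
        mult_left_le_one_le[of "\<bar>g y\<bar>" "\<bar>f x\<bar>"]
      by (auto simp: abs_mult)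
    \<comment> \<open>Signs of \<open>x\<close> and \<open>y\<close> are chosen to make
      \<open>f x\<close> and \<open>g y\<close> positive. Each sign change negates the tensor part
      and \<open>T x y\<close> together, so the absolute value of their difference is
      unchanged.\<close>
    then show ?thesis
      using near[of x y] near[of "- x" y] near[of x "- y"] near[of "- x" "- y"] xy f1 g1
      by (cases "f x \<ge> 0"; cases "g y \<ge> 0") (auto simp: blinfun.minus_right blinfun.minus_left abs_minus_commute)
  qed
  then show "\<bar>(L *\<^sub>R rank_one f g - T) x y\<bar> \<le> L - (1 - 5 * e)"
    by (simp add: blinfun.diff_left blinfun.scaleR_left)
qed

lemma uniformly_strongly_exposedD:
  fixes U :: "'a::real_normed_vector set"
  assumes "uniformly_strongly_exposed U" and "e > 0"
  shows "\<exists>(f :: 'a \<Rightarrow> ('a \<Rightarrow>\<^sub>L real)) \<delta>. \<delta> > 0 \<and>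
    (\<forall>u\<in>U. norm u = 1 \<and> norm (f u) = 1 \<and> blinfun_apply (f u) u = 1 \<and>
      (\<forall>z\<in>cball 0 1. blinfun_apply (f u) z > 1 - \<delta> \<longrightarrow> norm (u - z) < e))"
proof -
  obtain f :: "'a \<Rightarrow> ('a \<Rightarrow>\<^sub>L real)" where U: "U \<subseteq> sphere 0 1"
    and f: "\<forall>u\<in>U. norm (f u) = 1 \<and> blinfun_apply (f u) u = 1"
    and "\<forall>\<epsilon>>0. \<exists>\<delta>>0. \<forall>z\<in>cball 0 1. \<forall>u\<in>U. blinfun_apply (f u) z > 1 - \<delta> \<longrightarrow> norm (u - z) < \<epsilon>"
    using assms(1) unfolding uniformly_strongly_exposed_def by blast
  then obtain \<delta> where "\<delta> > 0"
    "\<forall>z\<in>cball 0 1. \<forall>u\<in>U. blinfun_apply (f u) z > 1 - \<delta> \<longrightarrow> norm (u - z) < e"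
    using assms(2) by blast
  with U f show ?thesis by (intro exI[of _ f] exI[of _ \<delta>]) auto
qed

text \<open>Every ball has the same radius, determined by \<open>\<alpha>\<close> and the exposing
  families; only the centres vary, over countably many pairs of net points.\<close>

lemma uniform_covering:
  fixes U :: "'a::real_normed_vector set" and V :: "'b::real_normed_vector set"
  assumes sep: "separable_space (euclidean :: 'a topology)" "separable_space (euclidean :: 'b topology)"
    and U: "uniformly_strongly_exposed U" "cball 0 1 = closure (convex hull U)"
    and V: "uniformly_strongly_exposed V" "cball 0 1 = closure (convex hull V)"
    and \<alpha>: "0 < \<alpha>" "\<alpha> < 1"
  obtains R and C :: "(('a \<Rightarrow>\<^sub>L ('b \<Rightarrow>\<^sub>L real)) \<times> real) set"
  where "R > 0" "countable_ball_covering C" "\<And>z r. (z, r) \<in> C \<Longrightarrow> norm z \<ge> r + \<alpha> \<and> r \<le> R"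
proof -
  \<comment> \<open>The total loss is \<open>5 * e\<close>: \<open>2 * e\<close> for almost
    attaining the norm, \<open>e\<close> for passing to the nets and \<open>2 * e\<close> for the
    near case. It must stay strictly below \<open>1 - \<alpha>\<close>, since the balls are
    open.\<close>
  define e where "e = (1 - \<alpha>) / 8"
  have e: "e > 0" "\<alpha> < 1 - 5 * e" "3 * e \<le> 1" using \<alpha> by (auto simp: e_def field_simps)
  obtain f :: "'a \<Rightarrow> ('a \<Rightarrow>\<^sub>L real)" and \<delta>1 where d1: "\<delta>1 > 0"
    and f: "\<forall>u\<in>U. norm u = 1 \<and> norm (f u) = 1 \<and> blinfun_apply (f u) u = 1 \<and>
      (\<forall>z\<in>cball 0 1. blinfun_apply (f u) z > 1 - \<delta>1 \<longrightarrow> norm (u - z) < e)"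
    using uniformly_strongly_exposedD[OF U(1) e(1)] by (elim exE conjE)
  obtain g :: "'b \<Rightarrow> ('b \<Rightarrow>\<^sub>L real)" and \<delta>2 where d2: "\<delta>2 > 0"
    and g: "\<forall>v\<in>V. norm v = 1 \<and> norm (g v) = 1 \<and> blinfun_apply (g v) v = 1 \<and>
      (\<forall>z\<in>cball 0 1. blinfun_apply (g v) z > 1 - \<delta>2 \<longrightarrow> norm (v - z) < e)"
    using uniformly_strongly_exposedD[OF V(1) e(1)] by (elim exE conjE)
  \<comment> \<open>One \<delta> serves both exposing families; the cap at 1 yields
    \<open>L \<ge> 2\<close>.\<close>
  define \<delta> where "\<delta> = min 1 (min \<delta>1 \<delta>2)"
  define L where "L = 2 / \<delta>"
  have \<delta>: "0 < \<delta>" "\<delta> \<le> 1" "\<delta> \<le> \<delta>1" "\<delta> \<le> \<delta>2" using d1 d2 by (auto simp: \<delta>_def)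
  then have L: "L * \<delta> = 2" "L \<ge> 2" by (auto simp: L_def field_simps)
  obtain M where M: "countable M" "M \<subseteq> U" "\<And>u. u \<in> U \<Longrightarrow> \<exists>n\<in>M. dist u n < e / 2"
    using countable_net_of_separable[OF sep(1), of "e / 2"] e by auto
  obtain N where N: "countable N" "N \<subseteq> V" "\<And>v. v \<in> V \<Longrightarrow> \<exists>n\<in>N. dist v n < e / 2"
    using countable_net_of_separable[OF sep(2), of "e / 2"] e by auto
  \<comment> \<open>The centres have norm at least \<open>L\<close>, so the radius
    \<open>L - \<alpha>\<close> leaves exactly the required gap \<alpha>.\<close>
  define C where "C = (\<lambda>(u, v). (L *\<^sub>R rank_one (f u) (g v), L - \<alpha>)) ` (M \<times> N)"
  have "sphere 0 1 \<subseteq> (\<Union>(z, r)\<in>C. ball z r)"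
  proof
    fix T :: "'a \<Rightarrow>\<^sub>L ('b \<Rightarrow>\<^sub>L real)" assume "T \<in> sphere 0 1"
    then have T: "norm T = 1" by simp
    obtain u v where uv: "u \<in> U" "v \<in> V" "T u v > 1 - 2 * e"
      using bilinear_almost_attains_norm[OF U(2) V(2), of "1 - 2 * e" T] T e by auto
    obtain u' v' where uv': "u' \<in> M" "v' \<in> N" "dist u u' < e / 2" "dist v v' < e / 2"
      using M(3)[OF uv(1)] N(3)[OF uv(2)] by blast
    have in_UV: "u' \<in> U" "v' \<in> V" using uv' M N by auto
    have "T u v - T u' v' \<le> 2 * (e / 2)"
      using T f g uv uv' in_UV by (intro bilinear_diff_le) (auto simp: dist_norm)
    then have "T u' v' > 1 - 3 * e" using uv by simp
    then have "norm (L *\<^sub>R rank_one (f u') (g v') - T) \<le> L - (1 - 5 * e)"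
      using T f g in_UV \<delta> L e
      by (intro norm_scaled_rank_one_diff_le[where u = u' and v = v' and \<delta> = \<delta>]) auto
    then have "T \<in> ball (L *\<^sub>R rank_one (f u') (g v')) (L - \<alpha>)"
      using e by (simp add: dist_norm)
    then show "T \<in> (\<Union>(z, r)\<in>C. ball z r)"
      using uv' unfolding C_def by force
  qed
  then have "countable_ball_covering C"
    using M N L \<alpha> by (auto simp: countable_ball_covering_def C_def)
  moreover have "norm z \<ge> r + \<alpha> \<and> r \<le> L" if zr: "(z, r) \<in> C" for z r
  proof -
    obtain u v where "u \<in> M" "v \<in> N" and z: "z = L *\<^sub>R rank_one (f u) (g v)" "r = L - \<alpha>"
      using zr by (auto simp: C_def)
    then have "u \<in> U" "v \<in> V" using M N by auto
    then have "1 \<le> norm (rank_one (f u) (g v))"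
      using norm_rank_one[of u "f u" "g v"] f g by simp
    then show ?thesis using L z \<alpha> mult_left_mono[of 1 "norm (rank_one (f u) (g v))" L] by simp
  qed
  ultimately show ?thesis using that[of L C] L by simp
qed

lemma UBCP_and_bc_blinfun_dual:
  fixes U :: "'a::real_normed_vector set" and V :: "'b::real_normed_vector set"
  assumes "separable_space (euclidean :: 'a topology)" "separable_space (euclidean :: 'b topology)"
    and "uniformly_strongly_exposed U" "cball 0 1 = closure (convex hull U)"
    and "uniformly_strongly_exposed V" "cball 0 1 = closure (convex hull V)"
  shows "UBCP TYPE('a \<Rightarrow>\<^sub>L ('b \<Rightarrow>\<^sub>L real))" and "bc TYPE('a \<Rightarrow>\<^sub>L ('b \<Rightarrow>\<^sub>L real)) = 1"
proof -
  note cov = uniform_covering[OF assms]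
  obtain R and C :: "(('a \<Rightarrow>\<^sub>L ('b \<Rightarrow>\<^sub>L real)) \<times> real) set"
    where "R > 0" "countable_ball_covering C" "\<And>z r. (z, r) \<in> C \<Longrightarrow> norm z \<ge> r + 1 / 2 \<and> r \<le> R"
    using cov[of "1 / 2"] by auto
  then show "UBCP TYPE('a \<Rightarrow>\<^sub>L ('b \<Rightarrow>\<^sub>L real))"
    unfolding UBCP_def by (intro exI[of _ R] conjI exI[of _ "1 / 2"] exI[of _ C]) auto
  define A where "A = {\<alpha>\<in>{-1..<1}. BCP \<alpha> TYPE('a \<Rightarrow>\<^sub>L ('b \<Rightarrow>\<^sub>L real))}"
  \<comment> \<open>Membership of the whole interval from 0 to 1 already forces the supremum to be
    1.\<close>
  have A: "\<alpha> \<in> A" if \<alpha>: "0 < \<alpha>" "\<alpha> < 1" for \<alpha>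
  proof -
    obtain R and C :: "(('a \<Rightarrow>\<^sub>L ('b \<Rightarrow>\<^sub>L real)) \<times> real) set"
      where "countable_ball_covering C" "\<And>z r. (z, r) \<in> C \<Longrightarrow> norm z \<ge> r + \<alpha> \<and> r \<le> R"
      using cov[OF \<alpha>] by metis
    then show ?thesis using \<alpha> by (force simp: A_def BCP_def)
  qed
  have "Sup A = 1"
  proof (rule cSup_eq_non_empty)
    show "A \<noteq> {}" using A[of "1 / 2"] by auto
    show "x \<le> 1" if "x \<in> A" for x using that by (simp add: A_def)
    show "1 \<le> y" if "\<And>x. x \<in> A \<Longrightarrow> x \<le> y" for y
      using that A by (intro dense_le_bounded[of 0 1 y]) auto
  qed
  moreover have "A \<noteq> {}" using A[of "1 / 2"] by auto
  ultimately show "bc TYPE('a \<Rightarrow>\<^sub>L ('b \<Rightarrow>\<^sub>L real)) = 1"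
    by (simp only: bc_def A_def[symmetric] Let_def if_False)
qed

theorem theoremC:
  fixes U :: "'a::banach set" and V :: "'b::banach set"
  assumes "separable_space (euclidean :: 'a topology)"
    and "separable_space (euclidean :: 'b topology)"
    and "uniformly_strongly_exposed U" and "cball 0 1 = closure (convex hull U)"
    and "uniformly_strongly_exposed V" and "cball 0 1 = closure (convex hull V)"
  shows "UBCP TYPE('a \<Rightarrow>\<^sub>L ('b \<Rightarrow>\<^sub>L real)) \<and> UBCP TYPE('b \<Rightarrow>\<^sub>L ('a \<Rightarrow>\<^sub>L real)) \<and>
    bc TYPE('a \<Rightarrow>\<^sub>L ('b \<Rightarrow>\<^sub>L real)) = 1 \<and> bc TYPE('b \<Rightarrow>\<^sub>L ('a \<Rightarrow>\<^sub>L real)) = 1"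
  \<comment> \<open>The hypotheses are symmetric in the two spaces, so the second half follows by
    exchanging their roles.\<close>
  using UBCP_and_bc_blinfun_dual[OF assms]
    UBCP_and_bc_blinfun_dual[OF assms(2,1,5,6,3,4)] by blast

end
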